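(* Let $U$ and $T$ be cyclic $t$-shapes. Then $U\in B(T)$ if and only if $D(U)=T$.
   Context: A $t$-shape of width $w\ge 1$ is a finite formal sequence $t^{\varepsilon_1}t^{\varepsilon_2}\cdots t^{\varepsilon_w}$ with each $\varepsilon_i\in\{1,-1\}$ (no cancellation is performed); a cyclic $t$-shape is a $t$-shape considered up to cyclic permutation. In particular cyclic $t$-shapes are non-empty. Magnus derivative $D$: arrange the signs of the exponents of a cyclic $t$-shape $T$ around a circle. Between each two cyclically consecutive signs $+,+$ insert a new $+$; between each two cyclically consecutive signs $-,-$ insert a new $-$; in all other cases insert nothing. Then delete the original signs. The remaining cyclic sequence of (new) signs defines $D(T)$, which may be empty; $D$ of the empty sequence is empty. (For width $1$, the single letter is cyclically adjacent to itself, so $D(t)=t$.) Blocks and blow-ups: for an integer $m\ge 0$, an $m$-block is a finite, possibly empty, non-cyclic sequence $t^{\varepsilon_1}\cdots t^{\varepsilon_k}$, $\varepsilon_i=\pm1$, with total sum $\varepsilon_1+\dots+\varepsilon_k=0$ and all of whose partial sums $\varepsilon_1+\dots+\varepsilon_i$ ($0\le i\le k$) lie in $[-m,0]$. It is full if some partial sum (including the empty one) equals $-m$. An $m$-blow up of a cyclic $t$-shape $T$ is any cyclic $t$-shape obtained by inserting, between each pair of cyclically consecutive letters of $T$, an $m$-block, where the block inserted between a pair $t^{-1},t$ (in this order) must be full; the blocks are otherwise arbitrary and chosen independently. $B^m(T)$ denotes the set of all $m$-blow ups of $T$, and $B=B^1$. *)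

theory Defs
  imports Main
begin

text \<open>The letters t and its inverse are represented by the signs of their exponents, and a
  t-shape of width w by a list of w signs.\<close>

datatype sign = Plus | Minus

fun exponent :: "sign \<Rightarrow> int" where
  "exponent Plus = 1"
| "exponent Minus = - 1"

definition cyc_eq :: "sign list \<Rightarrow> sign list \<Rightarrow> bool" where
  "cyc_eq xs ys \<longleftrightarrow> (\<exists>n. ys = rotate n xs)"

lemma cyc_eq_refl: "cyc_eq xs xs"
  unfolding cyc_eq_def by (metis rotate0 id_apply)

lemma cyc_eq_sym: assumes "cyc_eq xs ys" shows "cyc_eq ys xs"
proof (cases "xs = []")
  case True
  with assms show ?thesis by (auto simp: cyc_eq_def)
next
  case False
  from assms obtain n where n: "ys = rotate n xs" by (auto simp: cyc_eq_def)
  let ?m = "length xs - n mod length xs"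
  have "?m + n mod length xs = length xs" using False by (simp add: less_imp_le)
  then have "rotate ?m (rotate (n mod length xs) xs) = rotate (length xs) xs"
    by (simp only: rotate_rotate)
  then have "rotate ?m ys = xs" using n by (metis rotate_conv_mod rotate_length01 rotate_id mod_self)
  then show ?thesis unfolding cyc_eq_def by metis
qed

lemma cyc_eq_trans: "cyc_eq xs ys \<Longrightarrow> cyc_eq ys zs \<Longrightarrow> cyc_eq xs zs"
  unfolding cyc_eq_def by (metis rotate_rotate)

text \<open>Cyclic sequences of signs, the empty one included because it is a possible value of the
  Magnus derivative. Cyclic t-shapes are the non-empty ones.\<close>

quotient_type cyc_seq = "sign list" / cyc_eq
  morphisms rep_cyc_seq cyc
  by (rule equivpI)
    (auto intro!: reflpI sympI transpI intro: cyc_eq_refl cyc_eq_sym cyc_eq_trans)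

lift_definition cyc_width :: "cyc_seq \<Rightarrow> nat" is length
  by (auto simp: cyc_eq_def)

definition cyclic_t_shape :: "cyc_seq \<Rightarrow> bool" where
  "cyclic_t_shape T \<longleftrightarrow> cyc_width T \<ge> 1"

fun new_signs :: "sign \<Rightarrow> sign \<Rightarrow> sign list" where
  "new_signs Plus Plus = [Plus]"
| "new_signs Minus Minus = [Minus]"
| "new_signs Plus Minus = []"
| "new_signs Minus Plus = []"

text \<open>In \<open>zip xs (rotate1 xs)\<close> each letter is paired with its cyclic successor; a single
  letter is its own successor.\<close>

definition magnus_list :: "sign list \<Rightarrow> sign list" where
  "magnus_list xs = concat (map (\<lambda>(a, b). new_signs a b) (zip xs (rotate1 xs)))"

lemma magnus_list_rotate1: "cyc_eq (magnus_list xs) (magnus_list (rotate1 xs))"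
proof (cases xs)
  case Nil
  then show ?thesis by (simp add: cyc_eq_refl)
next
  case (Cons x ys)
  have z: "zip (rotate1 xs) (rotate1 (rotate1 xs)) = rotate1 (zip xs (rotate1 xs))"
  proof (cases ys)
    case Nil
    then show ?thesis using Cons by simp
  next
    case (Cons a zs)
    have "zip ((a # zs) @ [x]) ((zs @ [x]) @ [a]) = zip (a # zs) (zs @ [x]) @ [(x, a)]"
      by (subst zip_append) auto
    then show ?thesis using \<open>xs = x # ys\<close> Cons by simp
  qed
  define ps where "ps = zip xs (rotate1 xs)"
  obtain p qs where ps: "ps = p # qs" using Cons by (cases ps) (auto simp: ps_def)
  let ?f = "\<lambda>(a, b). new_signs a b"
  have "magnus_list xs = ?f p @ concat (map ?f qs)"
    by (simp add: magnus_list_def ps_def[symmetric] ps)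
  moreover have "magnus_list (rotate1 xs) = concat (map ?f qs) @ ?f p"
    by (simp add: magnus_list_def z ps_def[symmetric] ps)
  ultimately show ?thesis
    unfolding cyc_eq_def by (metis rotate_append)
qed

lemma magnus_list_rotate: "cyc_eq (magnus_list xs) (magnus_list (rotate n xs))"
  by (induction n) (auto intro: cyc_eq_refl cyc_eq_trans magnus_list_rotate1)

lift_definition magnus_derivative :: "cyc_seq \<Rightarrow> cyc_seq" is magnus_list
  by (metis cyc_eq_def magnus_list_rotate)

definition partial_sum :: "sign list \<Rightarrow> nat \<Rightarrow> int" where
  "partial_sum b i = sum_list (map exponent (take i b))"

definition is_block :: "nat \<Rightarrow> sign list \<Rightarrow> bool" where
  "is_block m b \<longleftrightarrow> partial_sum b (length b) = 0 \<and>
     (\<forall>i \<le> length b. - int m \<le> partial_sum b i \<and> partial_sum b i \<le> 0)"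

definition full_block :: "nat \<Rightarrow> sign list \<Rightarrow> bool" where
  "full_block m b \<longleftrightarrow> is_block m b \<and> (\<exists>i \<le> length b. partial_sum b i = - int m)"

text \<open>The block \<open>bs ! i\<close> is inserted between the letter \<open>xs ! i\<close> and its cyclic successor.\<close>

definition blow_up_list :: "nat \<Rightarrow> sign list \<Rightarrow> sign list \<Rightarrow> bool" where
  "blow_up_list m xs us \<longleftrightarrow> (\<exists>bs. length bs = length xs \<and>
     (\<forall>i < length xs. is_block m (bs ! i) \<and>
        (xs ! i = Minus \<and> xs ! (Suc i mod length xs) = Plus \<longrightarrow> full_block m (bs ! i))) \<and>
     us = concat (map (\<lambda>(x, b). x # b) (zip xs bs)))"

definition blow_ups :: "nat \<Rightarrow> cyc_seq \<Rightarrow> cyc_seq set" where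
  "blow_ups m T = {cyc us | xs us. cyc xs = T \<and> blow_up_list m xs us}"

end

theory Submission
  imports Defs
begin

text \<open>A 1-block is a power of \<open>t\<^sup>-\<^sup>1 t\<close>, and it is full iff it is non-empty. Hence, in a 1-blow up,
  the letter \<open>x\<close>, its block and the following letter \<open>y\<close> of \<open>T\<close> contribute to the derivative
  the sign \<open>-\<close> if \<open>x\<close> is negative, followed by \<open>+\<close> if \<open>y\<close> is positive. Thus every
  negative letter is produced just after itself and every positive one just before itself, and
  the derivative is \<open>T\<close>. Conversely, since the derivative determines \<open>T\<close>, it is enough to
  parse a sequence with non-empty derivative as a 1-blow up of something. This is done from right
  to left, after a rotation which brings two equal adjacent signs to the front.\<close>

declare One_nat_def [simp del]

section \<open>Blocks\<close>

lemma partial_sum_0 [simp]: "partial_sum b 0 = 0"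
  by (simp add: partial_sum_def)

lemma partial_sum_Cons [simp]: "partial_sum (x # b) (Suc i) = exponent x + partial_sum b i"
  by (simp add: partial_sum_def)

lemma is_block_Nil [simp]: "is_block m []"
  by (simp add: is_block_def)

lemma all_le_Suc: "(\<forall>i \<le> Suc n. P i) \<longleftrightarrow> P 0 \<and> (\<forall>i \<le> n. P (Suc i))"
  by (metis Suc_le_mono not0_implies_Suc zero_le)

lemma is_block_Cons: "is_block m (x # b) \<longleftrightarrow> exponent x + partial_sum b (length b) = 0 \<and>
    (\<forall>i \<le> length b. - int m \<le> exponent x + partial_sum b i \<and> exponent x + partial_sum b i \<le> 0)"
  by (simp add: is_block_def all_le_Suc)

text \<open>The prefix passes through \<open>-1\<close> and returns to \<open>0\<close>, so the
  partial sums of \<open>b\<close> are unshifted.\<close>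

lemma is_block_1_Minus_Plus [simp]: "is_block 1 (Minus # Plus # b) \<longleftrightarrow> is_block 1 b"
  by (simp add: is_block_Cons is_block_def all_le_Suc) (smt (verit))

text \<open>Partial sums in \<open>[-1, 0]\<close> leave no choice: from \<open>0\<close> only
  \<open>Minus\<close> is possible, and from \<open>-1\<close> only \<open>Plus\<close>.\<close>

lemma is_block_1_cases:
  assumes "is_block 1 b"
  obtains "b = []" | c where "b = Minus # Plus # c" "is_block 1 c"
proof (cases b)
  case (Cons x d)
  have x: "x = Minus"
    using assms Cons by (cases x) (auto simp: is_block_Cons dest: spec[of _ 0])
  show ?thesis
  proof (cases d)
    case Nil
    then show ?thesis using assms Cons x by (simp add: is_block_Cons)
  next
    case (Cons y c)
    have "y = Plus"
      using assms \<open>b = x # d\<close> Cons x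
      by (cases y) (auto simp: is_block_Cons dest: spec[of _ "Suc 0"])
    then show ?thesis using that(2) assms \<open>b = x # d\<close> Cons x by simp
  qed
qed (use that in blast)

lemma full_block_1_iff: "full_block 1 b \<longleftrightarrow> is_block 1 b \<and> b \<noteq> []"
proof -
  have "\<exists>i \<le> length b. partial_sum b i = - 1" if "is_block 1 b" "b \<noteq> []"
    using that by (cases rule: is_block_1_cases) (auto intro!: exI[of _ "Suc 0"])
  then show ?thesis by (auto simp: full_block_def)
qed

section \<open>Blow-ups and derivatives along a sequence with a prescribed successor\<close>

definition blow_up_word :: "(sign \<times> sign list) list \<Rightarrow> sign list" where
  "blow_up_word ps = concat (map (\<lambda>(x, b). x # b) ps)"

lemma blow_up_word_simps [simp]:
  "blow_up_word [] = []"
  "blow_up_word ((x, b) # ps) = x # b @ blow_up_word ps"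
  by (simp_all add: blow_up_word_def)

lemma hd_blow_up_word: "hd (blow_up_word ps @ [z]) = hd (map fst ps @ [z])"
  by (cases ps) auto

text \<open>Here \<open>z\<close> is the letter that follows the last block.\<close>

fun admissible :: "nat \<Rightarrow> sign \<Rightarrow> (sign \<times> sign list) list \<Rightarrow> bool" where
  "admissible m z [] \<longleftrightarrow> True"
| "admissible m z ((x, b) # ps) \<longleftrightarrow> is_block m b \<and>
     (x = Minus \<and> hd (map fst ps @ [z]) = Plus \<longrightarrow> full_block m b) \<and> admissible m z ps"

lemma admissible_iff_nth: "admissible m z ps \<longleftrightarrow> (\<forall>i < length ps. is_block m (snd (ps ! i)) \<and>
    (fst (ps ! i) = Minus \<and> (map fst ps @ [z]) ! Suc i = Plus \<longrightarrow> full_block m (snd (ps ! i))))"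
proof (induction ps)
  case (Cons p ps)
  have "(\<forall>i < Suc (length ps). P i) \<longleftrightarrow> P 0 \<and> (\<forall>i < length ps. P (Suc i))" for P
    using less_Suc_eq_0_disj by auto
  then show ?case using Cons by (cases p) (simp add: hd_conv_nth)
qed simp

lemma nth_Suc_mod_length: "i < length xs \<Longrightarrow> xs ! (Suc i mod length xs) = (xs @ [hd xs]) ! Suc i"
  by (cases "Suc i = length xs") (auto simp: nth_append intro!: hd_conv_nth[symmetric])

text \<open>The cycle is cut open: with \<open>hd xs\<close> placed after the last block, cyclic
  successors become linear ones, which permits induction on lists.\<close>

lemma blow_up_list_iff: "blow_up_list m xs us \<longleftrightarrow>
    (\<exists>ps. map fst ps = xs \<and> admissible m (hd xs) ps \<and> us = blow_up_word ps)"
proof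
  assume "blow_up_list m xs us"
  then obtain bs where bs: "length bs = length xs"
      "\<forall>i < length xs. is_block m (bs ! i) \<and>
        (xs ! i = Minus \<and> xs ! (Suc i mod length xs) = Plus \<longrightarrow> full_block m (bs ! i))"
      "us = blow_up_word (zip xs bs)"
    by (auto simp: blow_up_list_def blow_up_word_def)
  then show "\<exists>ps. map fst ps = xs \<and> admissible m (hd xs) ps \<and> us = blow_up_word ps"
    by (intro exI[of _ "zip xs bs"]) (simp add: admissible_iff_nth nth_Suc_mod_length)
next
  assume "\<exists>ps. map fst ps = xs \<and> admissible m (hd xs) ps \<and> us = blow_up_word ps"
  then obtain ps where "map fst ps = xs" "admissible m (hd xs) ps" "us = blow_up_word ps"
    by blast
  then show "blow_up_list m xs us"
    unfolding blow_up_list_def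
    by (intro exI[of _ "map snd ps"])
      (auto simp: admissible_iff_nth nth_Suc_mod_length blow_up_word_def zip_map_fst_snd)
qed

fun derivative_before :: "sign \<Rightarrow> sign list \<Rightarrow> sign list" where
  "derivative_before z [] = []"
| "derivative_before z (x # xs) = new_signs x (hd (xs @ [z])) @ derivative_before z xs"

lemma magnus_list_eq_derivative_before: "magnus_list xs = derivative_before (hd xs) xs"
proof -
  have *: "concat (map (\<lambda>(a, b). new_signs a b) (zip ys (tl ys @ [z]))) = derivative_before z ys"
    for z ys
  proof (induction ys)
    case (Cons y ys)
    then show ?case by (cases ys) auto
  qed simp
  show ?thesis
    using *[of xs "hd xs"] by (cases xs) (auto simp: magnus_list_def)
qed

section \<open>The derivative of a 1-blow up\<close>

text \<open>The signs of \<open>Plus # b\<close> alternate and end in \<open>Plus\<close>, so only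
  the junction with what follows can produce a sign.\<close>

lemma derivative_before_Plus_block:
  assumes "is_block 1 b"
  shows "derivative_before z (Plus # b @ us) =
    new_signs Plus (hd (us @ [z])) @ derivative_before z us"
  using assms
proof (induction b rule: length_induct)
  case (1 b)
  from "1.prems" show ?case
    using "1.IH" by (cases rule: is_block_1_cases) auto
qed

text \<open>For \<open>x = Minus\<close>, the sign \<open>Minus\<close> arises between
  \<open>x\<close> and the start of its block or, if the block is empty, between \<open>x\<close>
  and the next letter, which is then negative. The rest is as after a \<open>Plus\<close>.\<close>

lemma derivative_before_letter_block:
  assumes "is_block 1 b" "x = Minus \<and> hd (us @ [z]) = Plus \<longrightarrow> b \<noteq> []"
  shows "derivative_before z (x # b @ us) =
    (if x = Minus then [Minus] else []) @ (if hd (us @ [z]) = Plus then [Plus] else []) @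
    derivative_before z us"
proof (cases x)
  case Plus
  then show ?thesis
    using derivative_before_Plus_block[OF assms(1)] by (cases "hd (us @ [z])") auto
next
  case Minus
  from assms(1) show ?thesis
  proof (cases rule: is_block_1_cases)
    case 1
    then show ?thesis using Minus assms(2) by (cases "hd (us @ [z])") auto
  next
    case (2 c)
    then show ?thesis
      using Minus derivative_before_Plus_block[OF 2(2), of z us]
      by (cases "hd (us @ [z])") auto
  qed
qed

text \<open>Positive letters are produced one gap early: the one in front is missing from the
  derivative, while \<open>z\<close> is produced in the last gap. The added signs balance this, so
  the induction telescopes.\<close>

lemma derivative_before_blow_up_word:
  assumes "admissible 1 z ps"
  shows "(if hd (map fst ps @ [z]) = Plus then [Plus] else []) @
      derivative_before z (blow_up_word ps) =
    map fst ps @ (if z = Plus then [Plus] else [])"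
  using assms
proof (induction ps)
  case (Cons p ps)
  obtain x b where p: "p = (x, b)" by fastforce
  have "derivative_before z (x # b @ blow_up_word ps) =
      (if x = Minus then [Minus] else []) @
      (if hd (map fst ps @ [z]) = Plus then [Plus] else []) @
      derivative_before z (blow_up_word ps)"
    using Cons.prems p derivative_before_letter_block[of b x "blow_up_word ps" z]
    by (auto simp: full_block_1_iff hd_blow_up_word)
  then show ?case using Cons p by (cases x) auto
qed simp

lemma cyc_eq_magnus_list_blow_up:
  assumes "blow_up_list 1 xs us"
  shows "cyc_eq xs (magnus_list us)"
proof (cases xs)
  case Nil
  then show ?thesis
    using assms by (auto simp: blow_up_list_def magnus_list_def cyc_eq_refl)
next
  case (Cons x ys)
  obtain ps where ps: "map fst ps = xs" "admissible 1 x ps" "us = blow_up_word ps"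
    using assms Cons unfolding blow_up_list_iff by (metis list.sel(1))
  have "hd us = x" using ps Cons by (cases ps) auto
  then have "(if x = Plus then [Plus] else []) @ magnus_list us =
      xs @ (if x = Plus then [Plus] else [])"
    using derivative_before_blow_up_word[OF ps(2)] ps Cons
    by (simp add: magnus_list_eq_derivative_before)
  \<comment> \<open>For \<open>x = Plus\<close>, cancelling the leading \<open>Plus\<close> moves
    the first letter of \<open>xs\<close> to the end.\<close>
  then have "magnus_list us = (if x = Plus then rotate1 xs else xs)"
    using Cons by (auto split: if_splits)
  then show ?thesis
    unfolding cyc_eq_def by (metis rotate0 id_apply rotate_Suc)
qed

section \<open>Parsing a sequence as a 1-blow up\<close>

text \<open>The word \<open>b\<close> is the end of the block of a letter preceding \<open>us\<close>. A negative sign becomes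
  a letter only if the next sign is negative too; hence its block is non-empty, so full, whenever
  the next letter is positive.\<close>

lemma parse_blow_up:
  assumes "z = Plus \<Longrightarrow> us \<noteq> [] \<Longrightarrow> last us = Plus"
  shows "\<exists>b ps. us = b @ blow_up_word ps \<and> is_block 1 b \<and> admissible 1 z ps"
  using assms
proof (induction us rule: induct_list012)
  case 1
  show ?case by (intro exI[of _ "[]"]) simp
next
  \<comment> \<open>The sign becomes a letter with empty block. The hypothesis excludes
    \<open>x = Minus\<close>, \<open>z = Plus\<close>, where the block must be full.\<close>
  case (2 x)
  then show ?case
    by (intro exI[of _ "[]"] exI[of _ "[(x, [])]"]) (cases x; cases z; auto)
next
  case (3 x y us)
  obtain b ps where IH: "y # us = b @ blow_up_word ps" "is_block 1 b" "admissible 1 z ps"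
    using 3 by auto
  show ?case
  proof (cases "x = Minus \<and> y = Plus")
    case True
    obtain c qs where "us = c @ blow_up_word qs" "is_block 1 c" "admissible 1 z qs"
      using "3.IH"(1) "3.prems" by (metis last_ConsR list.simps(3))
    then show ?thesis
      using True by (intro exI[of _ "Minus # Plus # c"] exI[of _ qs]) simp
  next
    case False
    have "b \<noteq> []" if "x = Minus" "hd (map fst ps @ [z]) = Plus"
    proof
      assume "b = []"
      then have "hd (blow_up_word ps @ [z]) = y"
        using IH(1) by (metis append_Cons append_Nil list.sel(1))
      then show False using that False by (simp add: hd_blow_up_word)
    qed
    then show ?thesis
      using IH by (intro exI[of _ "[]"] exI[of _ "(x, b) # ps"]) (auto simp: full_block_1_iff)
  qed
qed

lemma blow_up_list_if_parsed:
  assumes "us = blow_up_word ps" "admissible m (hd us) ps" "us \<noteq> []"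
  shows "\<exists>xs. blow_up_list m xs us"
proof -
  have "hd (map fst ps) = hd us" using assms by (cases ps) auto
  then show ?thesis using assms unfolding blow_up_list_iff by metis
qed

text \<open>A new sign comes from two equal cyclic neighbours, which are rotated to the front; a
  single letter is its own neighbour.\<close>

lemma magnus_list_nonempty_rotate:
  assumes "magnus_list us \<noteq> []"
  obtains n a vs where "rotate n us = [a] \<or> rotate n us = a # a # vs"
proof -
  have "a = b" if "new_signs a b \<noteq> []" for a b
    using that by (cases a; cases b) auto
  then obtain a where "(a, a) \<in> set (zip us (rotate1 us))"
    using assms by (fastforce simp: magnus_list_def)
  then obtain i where i: "i < length us" "us ! i = a" "rotate1 us ! i = a"
    by (auto simp: set_zip)
  define vs where "vs = rotate i us"
  have len: "length vs = length us" by (simp add: vs_def)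
  have vs0: "vs ! 0 = a" using i nth_rotate[of 0 us i] by (cases us) (auto simp: vs_def)
  have vs1: "vs ! 1 = a" if "1 < length vs"
    using i that by (simp add: vs_def nth_rotate nth_rotate1 One_nat_def)
  show ?thesis
  proof (cases vs)
    case Nil
    then show ?thesis using len i by simp
  next
    case (Cons x ws)
    then have "vs = [a] \<or> vs = a # a # tl ws" using vs0 vs1 by (cases ws) auto
    then show ?thesis using that[of i] by (simp add: vs_def)
  qed
qed

lemma rotation_is_blow_up:
  assumes "magnus_list us \<noteq> []"
  shows "\<exists>n xs. blow_up_list 1 xs (rotate n us)"
proof -
  obtain n a vs where n: "rotate n us = [a] \<or> rotate n us = a # a # vs"
    using magnus_list_nonempty_rotate[OF assms] .
  show ?thesis
  proof (cases a)
    case Plus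
    \<comment> \<open>Rotating \<open>a # a # vs\<close> once more leaves one \<open>Plus\<close> in
      front and puts the other last, as parsing before \<open>Plus\<close> requires.\<close>
    obtain k ws where k: "rotate k us = Plus # ws" "last (Plus # ws) = Plus"
    proof (cases "rotate n us = [a]")
      case True
      then show ?thesis using that[of n] Plus by simp
    next
      case False
      then have "rotate (Suc n) us = Plus # vs @ [Plus]" using n Plus by simp
      then show ?thesis using that[of "Suc n"] by simp
    qed
    obtain b ps where b: "Plus # ws = b @ blow_up_word ps" "is_block 1 b" "admissible 1 Plus ps"
      using parse_blow_up[of Plus "Plus # ws"] k(2) by auto
    from b(2) have "b = []" using b(1) by (cases rule: is_block_1_cases) auto
    then have "\<exists>xs. blow_up_list 1 xs (Plus # ws)"
      using b blow_up_list_if_parsed[of "Plus # ws" ps 1] by (metis append_Nil list.sel(1) list.distinct(1))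
    then show ?thesis using k(1) by metis
  next
    case Minus
    obtain b ps where b: "rotate n us = b @ blow_up_word ps" "is_block 1 b" "admissible 1 Minus ps"
      using parse_blow_up[of Minus "rotate n us"] by auto
    \<comment> \<open>A non-empty 1-block starts with \<open>Minus\<close>, \<open>Plus\<close>,
      which the front of the rotated sequence rules out.\<close>
    from b(2) have "b = []" using b(1) n Minus by (cases rule: is_block_1_cases) auto
    then have "\<exists>xs. blow_up_list 1 xs (rotate n us)"
      using b n Minus blow_up_list_if_parsed[of "rotate n us" ps 1] by auto
    then show ?thesis by blast
  qed
qed

theorem lemma3p1:
  fixes U T :: cyc_seq
  assumes "cyclic_t_shape U" and "cyclic_t_shape T"
  shows "U \<in> blow_ups 1 T \<longleftrightarrow> magnus_derivative U = T"
proof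
  assume "U \<in> blow_ups 1 T"
  then obtain xs us where *: "U = cyc us" "cyc xs = T" "blow_up_list 1 xs us"
    by (auto simp: blow_ups_def)
  then have "cyc (magnus_list us) = cyc xs"
    by (metis cyc_eq_magnus_list_blow_up cyc_seq.abs_eq_iff)
  then show "magnus_derivative U = T"
    using * by (simp add: magnus_derivative.abs_eq)
next
  assume D: "magnus_derivative U = T"
  obtain us where us: "U = cyc us" by (metis Quotient3_abs_rep Quotient3_cyc_seq)
  then have T: "T = cyc (magnus_list us)" using D by (simp add: magnus_derivative.abs_eq)
  then have "magnus_list us \<noteq> []"
    using assms(2) by (auto simp: cyclic_t_shape_def cyc_width.abs_eq)
  then obtain n xs where xs: "blow_up_list 1 xs (rotate n us)"
    using rotation_is_blow_up by blast
  have U: "U = cyc (rotate n us)"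
    using us by (auto simp: cyc_seq.abs_eq_iff cyc_eq_def)
  have "T = cyc (magnus_list (rotate n us))"
    using D U by (simp add: magnus_derivative.abs_eq)
  \<comment> \<open>The forward direction identifies the parsed \<open>xs\<close> as a
    representative of \<open>T\<close>.\<close>
  also have "\<dots> = cyc xs"
    using cyc_eq_magnus_list_blow_up[OF xs] by (simp add: cyc_seq.abs_eq_iff cyc_eq_sym)
  finally show "U \<in> blow_ups 1 T"
    using xs U by (auto simp: blow_ups_def)
qed

end
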